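(* The optimal randomized competitive ratio for One-out-of-$m$ Paging with $k$ slots and $m=\lfloor k/2\rfloor$ is $\Omega(k)$.
   Context: Slot-Heterogenous Paging: cache slots $[k]$, family $\mathcal{F}$ of requestable nonempty slot sets, requests $(p,S)$ with $p$ a page and $S\in\mathcal{F}$. A configuration assigns to each slot a single page or nothing and satisfies $(p,S)$ if some slot in $S$ holds $p$. A solution is a sequence of configurations satisfying the requests in order; its cost is the number of retrievals (page $p$ retrieved in slot $s$ at time $t$ if $C_t$ assigns $p$ to $s$ but $C_{t-1}$ does not, or $t=1$). A randomized online algorithm is $c$-competitive if its expected cost is at most $c\cdot\mathrm{OPT}(\sigma)+b$ for every request sequence $\sigma$, for a constant $b$ independent of $\sigma$; the optimal randomized competitive ratio is the infimum of such $c$. One-out-of-$m$ Paging is the case $\mathcal{F}=\{S\subseteq[k]:|S|=m\}$. *)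

theory Defs
  imports "HOL-Probability.Probability"
begin

text \<open>Pages are drawn from a countably infinite universe; the slots are \<open>{1..k}\<close>.\<close>

type_synonym page = nat
type_synonym slot = nat
type_synonym request = "page \<times> slot set"
type_synonym config = "slot \<rightharpoonup> page"

definition configs :: "nat \<Rightarrow> config set" where
  "configs k = {C. dom C \<subseteq> {1..k}}"

fun satisfies :: "config \<Rightarrow> request \<Rightarrow> bool" where
  "satisfies C (p, S) \<longleftrightarrow> (\<exists>s\<in>S. C s = Some p)"

definition request_seqs :: "slot set set \<Rightarrow> request list set" where
  "request_seqs F = lists (UNIV \<times> F)"

definition is_solution :: "nat \<Rightarrow> request list \<Rightarrow> config list \<Rightarrow> bool" where
  "is_solution k \<sigma> Cs \<longleftrightarrow>
     length Cs = length \<sigma> \<and> set Cs \<subseteq> configs k \<and>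
     (\<forall>t<length \<sigma>. satisfies (Cs ! t) (\<sigma> ! t))"

text \<open>List positions count from 0, so \<open>t = 0\<close> is the first time step.\<close>

definition retrievals :: "config list \<Rightarrow> (nat \<times> slot \<times> page) set" where
  "retrievals Cs = {(t, s, p). t < length Cs \<and> (Cs ! t) s = Some p \<and>
     (t = 0 \<or> (Cs ! (t - 1)) s \<noteq> Some p)}"

definition cost :: "config list \<Rightarrow> nat" where
  "cost Cs = card (retrievals Cs)"

definition opt_cost :: "nat \<Rightarrow> request list \<Rightarrow> nat" where
  "opt_cost k \<sigma> = Inf {cost Cs | Cs. is_solution k \<sigma> Cs}"

text \<open>A deterministic online algorithm maps each sequence of requests seen so far to the
  configuration it adopts after the last of them.\<close>

type_synonym online_alg = "request list \<Rightarrow> config"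

definition run :: "online_alg \<Rightarrow> request list \<Rightarrow> config list" where
  "run A \<sigma> = map (\<lambda>t. A (take (Suc t) \<sigma>)) [0..<length \<sigma>]"

definition correct_alg :: "nat \<Rightarrow> slot set set \<Rightarrow> online_alg \<Rightarrow> bool" where
  "correct_alg k F A \<longleftrightarrow> (\<forall>\<sigma>\<in>request_seqs F. is_solution k \<sigma> (run A \<sigma>))"

text \<open>A randomized online algorithm is a probability distribution on deterministic online
  algorithms. The \<open>\<sigma>\<close>-algebra is the one generated by the individual decisions; it makes
  the cost on every request sequence an integrable random variable
  (see \<open>integrable_cost_run\<close> below).\<close>

definition alg_space :: "nat \<Rightarrow> online_alg measure" where
  "alg_space k = PiM UNIV (\<lambda>_. count_space (configs k))"

definition randomized_alg :: "nat \<Rightarrow> slot set set \<Rightarrow> online_alg measure \<Rightarrow> bool" where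
  "randomized_alg k F M \<longleftrightarrow>
     prob_space M \<and> sets M = sets (alg_space k) \<and> (AE A in M. correct_alg k F A)"

definition expected_cost :: "online_alg measure \<Rightarrow> request list \<Rightarrow> real" where
  "expected_cost M \<sigma> = (\<integral>A. real (cost (run A \<sigma>)) \<partial>M)"

definition competitive :: "nat \<Rightarrow> slot set set \<Rightarrow> real \<Rightarrow> online_alg measure \<Rightarrow> bool" where
  "competitive k F c M \<longleftrightarrow>
     (\<exists>b::real. \<forall>\<sigma>\<in>request_seqs F. expected_cost M \<sigma> \<le> c * real (opt_cost k \<sigma>) + b)"

text \<open>The infimum is taken in the extended reals, so that the ratio is \<open>\<infinity>\<close> if
  no algorithm is competitive.\<close>

definition opt_randomized_ratio :: "nat \<Rightarrow> slot set set \<Rightarrow> ereal" where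
  "opt_randomized_ratio k F =
     Inf {ereal c | c. \<exists>M. randomized_alg k F M \<and> competitive k F c M}"

definition one_out_of :: "nat \<Rightarrow> nat \<Rightarrow> slot set set" where
  "one_out_of k m = {S. S \<subseteq> {1..k} \<and> card S = m}"

lemma solution_exists:
  assumes "F \<subseteq> Pow {1..k} - {{}}" and "\<sigma> \<in> request_seqs F"
  shows "\<exists>Cs. is_solution k \<sigma> Cs"
proof -
  define Cs :: "config list" where
    "Cs = map (\<lambda>r s. if s \<in> snd r then Some (fst r) else None) \<sigma>"
  have *: "snd r \<subseteq> {1..k} \<and> snd r \<noteq> {}" if "r \<in> set \<sigma>" for r
  proof -
    have "snd r \<in> F" using assms(2) that by (auto simp: request_seqs_def lists_eq_set)
    then show ?thesis using assms(1) by blast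
  qed
  have "set Cs \<subseteq> configs k"
  proof
    fix C assume "C \<in> set Cs"
    then obtain r where "r \<in> set \<sigma>"
      and C: "C = (\<lambda>s. if s \<in> snd r then Some (fst r) else None)"
      unfolding Cs_def set_map by blast
    then have "snd r \<subseteq> {1..k}" using * by blast
    then show "C \<in> configs k" by (auto simp: C configs_def split: if_splits)
  qed
  moreover have "satisfies (Cs ! t) (\<sigma> ! t)" if "t < length \<sigma>" for t
  proof -
    obtain p S where r: "\<sigma> ! t = (p, S)" by (cases "\<sigma> ! t")
    then have "S \<noteq> {}" using *[OF nth_mem[OF that]] by simp
    then show ?thesis using that r by (auto simp: Cs_def)
  qed
  ultimately have "is_solution k \<sigma> Cs"
    by (simp add: is_solution_def Cs_def)
  then show ?thesis ..
qed

lemma countable_configs: "countable (configs k)"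
proof -
  have "inj_on (\<lambda>C. map C [1..<Suc k]) (configs k)"
  proof (rule inj_onI, rule ext)
    fix C D s
    assume "C \<in> configs k" "D \<in> configs k" and eq: "map C [1..<Suc k] = map D [1..<Suc k]"
    then have "dom C \<subseteq> {1..k}" "dom D \<subseteq> {1..k}" by (auto simp: configs_def)
    moreover have "\<forall>s\<in>{1..k}. C s = D s" using eq by (auto simp: map_eq_conv)
    ultimately show "C s = D s" by (metis domIff subsetD)
  qed
  then show ?thesis by (rule countableI')
qed

lemma cost_le:
  assumes "set Cs \<subseteq> configs k"
  shows "cost Cs \<le> length Cs * k"
proof -
  have "inj_on (\<lambda>(t, s, p). (t, s)) (retrievals Cs)"
    by (auto simp: inj_on_def retrievals_def)
  moreover have "(\<lambda>(t, s, p). (t, s)) ` retrievals Cs \<subseteq> {..<length Cs} \<times> {1..k}"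
  proof -
    have "s \<in> {1..k}" if "t < length Cs" "(Cs ! t) s = Some p" for t s p
    proof -
      have "dom (Cs ! t) \<subseteq> {1..k}"
        using assms nth_mem[OF that(1)] unfolding configs_def by blast
      then show ?thesis using that(2) by blast
    qed
    then show ?thesis unfolding retrievals_def by fast
  qed
  ultimately have "card (retrievals Cs) \<le> card ({..<length Cs} \<times> {1..k})"
    by (intro card_inj_on_le) auto
  then show ?thesis by (simp add: cost_def)
qed

lemma measurable_run:
  "(\<lambda>A. run A \<sigma>) \<in> alg_space k \<rightarrow>\<^sub>M count_space (lists (configs k))"
proof -
  have sp: "A \<in> space (alg_space k) \<Longrightarrow> A \<tau> \<in> configs k" for A \<tau>
    by (auto simp: alg_space_def space_PiM)
  have "(\<lambda>A. run A \<sigma>) -` {Cs} \<inter> space (alg_space k) \<in> sets (alg_space k)" for Cs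
  proof -
    have [measurable]: "(\<lambda>A. A \<tau>) \<in> alg_space k \<rightarrow>\<^sub>M count_space (configs k)" for \<tau>
      unfolding alg_space_def by (rule measurable_component_singleton) simp
    have [measurable]: "Measurable.pred (alg_space k) (\<lambda>A. A \<tau> = C)" for \<tau> C
    proof -
      have "Measurable.pred (count_space (configs k)) (\<lambda>D. D = C)" by simp
      from measurable_compose[OF _ this] show ?thesis by measurable
    qed
    have "(\<lambda>A. run A \<sigma>) -` {Cs} \<inter> space (alg_space k) =
      {A \<in> space (alg_space k). length Cs = length \<sigma> \<and>
         (\<forall>t\<in>{..<length \<sigma>}. A (take (Suc t) \<sigma>) = Cs ! t)}"
    proof -
      have "run A \<sigma> = Cs \<longleftrightarrow> length Cs = length \<sigma> \<and>
        (\<forall>t\<in>{..<length \<sigma>}. A (take (Suc t) \<sigma>) = Cs ! t)" for A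
        unfolding run_def list_eq_iff_nth_eq by (simp add: Ball_def) metis
      then show ?thesis unfolding vimage_def by blast
    qed
    also have "\<dots> \<in> sets (alg_space k)" by measurable
    finally show ?thesis .
  qed
  moreover have "run A \<sigma> \<in> lists (configs k)" if "A \<in> space (alg_space k)" for A
    using sp[OF that] by (auto simp: run_def)
  ultimately show ?thesis
    by (subst measurable_count_space_eq_countable)
       (auto intro!: countable_lists countable_configs)
qed

lemma integrable_cost_run:
  assumes "randomized_alg k F M"
  shows "integrable M (\<lambda>A. real (cost (run A \<sigma>)))"
proof -
  interpret prob_space M using assms by (simp add: randomized_alg_def)
  have s: "sets M = sets (alg_space k)" using assms by (simp add: randomized_alg_def)
  have r: "(\<lambda>A. run A \<sigma>) \<in> M \<rightarrow>\<^sub>M count_space (lists (configs k))"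
    using measurable_run measurable_cong_sets[OF s refl] by blast
  have m: "(\<lambda>A. real (cost (run A \<sigma>))) \<in> borel_measurable M"
    by (rule measurable_compose[OF r]) simp
  have "AE A in M. norm (real (cost (run A \<sigma>))) \<le> real (length \<sigma> * k)"
  proof (rule AE_I2)
    fix A assume "A \<in> space M"
    then have "set (run A \<sigma>) \<subseteq> configs k"
      using measurable_space[OF r] by (auto simp: lists_eq_set)
    from cost_le[OF this] have "cost (run A \<sigma>) \<le> length \<sigma> * k"
      by (simp add: run_def)
    then show "norm (real (cost (run A \<sigma>))) \<le> real (length \<sigma> * k)"
      by (simp del: of_nat_mult)
  qed
  then show ?thesis by (rule integrable_const_bound[OF _ m])
qed

end

theory Submission imports Defs begin

text \<open>
  Let \<open>m = k div 2\<close>. Use only two pages, 0 and 1, and encode a configuration by the set of slots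
  holding page 0. By the Gilbert--Varshamov argument there is a code of \<open>N = exp (\<Omega>(k))\<close> sets of
  size \<open>k - m\<close> at pairwise distance \<open>d = \<Omega>(k)\<close>. For a set \<open>K\<close> of codewords, request everything that
  all codewords in \<open>K\<close> satisfy; a configuration satisfying all these requests must itself be a
  codeword in \<open>K\<close>. Repeating this round \<open>d\<close> times, an algorithm either pays \<open>d\<close> or visits a
  codeword in \<open>K\<close>. The problem thus behaves like a uniform metrical task system with \<open>N\<close> states at
  distance \<open>d\<close>: the adversary removes the codewords one by one, each time the one (chosen by
  averaging) where the algorithm is likely enough to be, so that with \<open>j\<close> codewords left the
  algorithm pays about \<open>d / j\<close>. In a phase it pays \<open>\<Omega>(d ln N) = \<Omega>(k\<^sup>2)\<close> in expectation, while
  moving to the last surviving codeword at the start of the phase costs at most \<open>k\<close>.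
\<close>

section \<open>Retrieval counts along a sequence of configurations\<close>

lemma finite_retrievals:
  assumes "set Cs \<subseteq> configs k"
  shows "finite (retrievals Cs)"
proof (rule finite_subset)
  have "p \<in> ran (Cs ! t) \<and> s \<in> {1..k}" if "t < length Cs" "(Cs ! t) s = Some p" for t s p
  proof -
    have "dom (Cs ! t) \<subseteq> {1..k}"
      using assms nth_mem[OF that(1)] unfolding configs_def by blast
    then show ?thesis using that(2) by (auto simp: ran_def)
  qed
  then show "retrievals Cs \<subseteq> (SIGMA t:{..<length Cs}. {1..k} \<times> ran (Cs ! t))"
    unfolding retrievals_def by fast
  have "finite (ran (Cs ! t))" if "t < length Cs" for t
  proof (rule finite_ran)
    have "dom (Cs ! t) \<subseteq> {1..k}"
      using assms nth_mem[OF that] unfolding configs_def by blast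
    then show "finite (dom (Cs ! t))" by (rule finite_subset) simp
  qed
  then show "finite (SIGMA t:{..<length Cs}. {1..k} \<times> ran (Cs ! t))"
    by (intro finite_SigmaI finite_cartesian_product) auto
qed

text \<open>The last summand is not \<open>cost Ds\<close>: what the first configuration of
  \<open>Ds\<close> retrieves depends on the last one of \<open>Cs\<close>, so late retrievals are
  counted within the whole list.\<close>

lemma cost_append:
  assumes "set (Cs @ Ds) \<subseteq> configs k"
  shows "cost (Cs @ Ds) = cost Cs + card {r \<in> retrievals (Cs @ Ds). length Cs \<le> fst r}"
proof -
  have eq: "retrievals (Cs @ Ds) =
      retrievals Cs \<union> {r \<in> retrievals (Cs @ Ds). length Cs \<le> fst r}"
    by (auto simp: retrievals_def nth_append split: if_splits)
  have "card (retrievals (Cs @ Ds)) =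
      card (retrievals Cs) + card {r \<in> retrievals (Cs @ Ds). length Cs \<le> fst r}"
    by (subst eq, rule card_Un_disjoint)
       (use assms finite_retrievals[OF assms] finite_retrievals[of Cs k]
         in \<open>auto simp: retrievals_def\<close>)
  then show ?thesis by (simp add: cost_def)
qed

text \<open>Only the first copy of \<open>C\<close> retrieves anything, at most one page per slot.
  This bounds what the offline solution pays in one phase.\<close>

lemma cost_append_replicate:
  assumes "set Cs \<subseteq> configs k" "C \<in> configs k"
  shows "cost (Cs @ replicate l C) \<le> cost Cs + k"
proof -
  let ?R = "{r \<in> retrievals (Cs @ replicate l C). length Cs \<le> fst r}"
  have inside: "set (Cs @ replicate l C) \<subseteq> configs k" using assms by auto
  have C: "dom C \<subseteq> {1..k}" using assms by (simp add: configs_def)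
  have "?R \<subseteq> (\<lambda>s. (length Cs, s, the (C s))) ` {1..k}"
  proof
    fix r assume r: "r \<in> ?R"
    obtain t s p where tsp: "r = (t, s, p)" by (metis prod_cases3)
    have t: "length Cs \<le> t" "t < length Cs + l" using r by (auto simp: tsp retrievals_def)
    have Cs: "C s = Some p" using r t by (auto simp: tsp retrievals_def nth_append)
    have "t = length Cs"
    proof (rule ccontr)
      assume "t \<noteq> length Cs"
      then have "(Cs @ replicate l C) ! (t - 1) = C" using t by (auto simp: nth_append)
      then show False using r Cs t \<open>t \<noteq> length Cs\<close> by (auto simp: tsp retrievals_def)
    qed
    moreover have "s \<in> {1..k}" using Cs C by blast
    ultimately show "r \<in> (\<lambda>s. (length Cs, s, the (C s))) ` {1..k}" using Cs tsp by auto
  qed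
  then have "card ?R \<le> card ((\<lambda>s. (length Cs, s, the (C s))) ` {1..k})"
    by (intro card_mono) auto
  also have "\<dots> \<le> k"
    using card_image_le[of "{1..k}"] by (metis card_atLeastAtMost diff_Suc_1 finite_atLeastAtMost)
  finally show ?thesis using cost_append[OF inside] by simp
qed

lemma run_append_take: "take (length \<tau>) (run A (\<tau> @ \<rho>)) = run A \<tau>"
  by (rule nth_equalityI) (auto simp: run_def)

lemma run_append: "run A (\<tau> @ \<rho>) = run A \<tau> @ drop (length \<tau>) (run A (\<tau> @ \<rho>))"
  by (metis append_take_drop_id run_append_take)

lemma length_run [simp]: "length (run A \<sigma>) = length \<sigma>"
  by (simp add: run_def)

lemma cost_run_append:
  assumes "is_solution k (\<tau> @ \<rho>) (run A (\<tau> @ \<rho>))"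
  shows "cost (run A (\<tau> @ \<rho>)) =
    cost (run A \<tau>) + card {r \<in> retrievals (run A (\<tau> @ \<rho>)). length \<tau> \<le> fst r}"
proof -
  have "set (run A \<tau> @ drop (length \<tau>) (run A (\<tau> @ \<rho>))) \<subseteq> configs k"
    using assms run_append[of A \<tau> \<rho>] by (simp add: is_solution_def)
  from cost_append[OF this] show ?thesis using run_append[of A \<tau> \<rho>] by simp
qed

lemma ex_retrieval_between:
  assumes "t < t'" "t' < length Cs" "(Cs ! t) s \<noteq> Some p" "(Cs ! t') s = Some p"
  shows "\<exists>u. t < u \<and> u \<le> t' \<and> (u, s, p) \<in> retrievals Cs"
  using assms
proof (induction "t' - t" arbitrary: t')
  case (Suc n)
  show ?case
  proof (cases "(Cs ! (t' - 1)) s = Some p")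
    case True
    then have "t \<noteq> t' - 1" using Suc.prems by auto
    then have "\<exists>u. t < u \<and> u \<le> t' - 1 \<and> (u, s, p) \<in> retrievals Cs"
      using Suc True by (intro Suc.hyps(1)) auto
    then show ?thesis by (meson diff_le_self le_trans)
  next
    case False
    then show ?thesis using Suc.prems by (intro exI[of _ t']) (auto simp: retrievals_def)
  qed
qed simp

text \<open>Every slot gained for \<open>p\<close> needs its own retrieval, whatever route the
  configurations take in between.\<close>

lemma card_retrievals_between:
  assumes "set Cs \<subseteq> configs k" "t < t'" "t' < length Cs"
  shows "card ({s. (Cs ! t') s = Some p} - {s. (Cs ! t) s = Some p})
    \<le> card {r \<in> retrievals Cs. t < fst r \<and> fst r \<le> t'}"
proof -
  let ?D = "{s. (Cs ! t') s = Some p} - {s. (Cs ! t) s = Some p}"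
  have "\<forall>s\<in>?D. \<exists>u. t < u \<and> u \<le> t' \<and> (u, s, p) \<in> retrievals Cs"
    using ex_retrieval_between[OF assms(2,3)] by blast
  then obtain u where u: "\<And>s. s \<in> ?D \<Longrightarrow> t < u s \<and> u s \<le> t' \<and> (u s, s, p) \<in> retrievals Cs"
    by (metis (no_types, lifting))
  show ?thesis
    by (rule card_inj_on_le[where f = "\<lambda>s. (u s, s, p)"])
       (use u finite_retrievals[OF assms(1)] in \<open>auto simp: inj_on_def\<close>)
qed

section \<open>Codewords as configurations, and request blocks\<close>

definition code_config :: "nat \<Rightarrow> slot set \<Rightarrow> config" where
  "code_config k C s = (if s \<in> {1..k} then Some (if s \<in> C then 0 else 1) else None)"

lemma code_config_in_configs: "code_config k C \<in> configs k"
  by (auto simp: configs_def code_config_def split: if_splits)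

definition slots_with_0 :: "config \<Rightarrow> slot set" where
  "slots_with_0 c = {s. c s = Some 0}"

text \<open>A codeword \<open>C\<close> rules out \<open>(0, S)\<close> exactly when
  \<open>S\<close> misses \<open>C\<close>, and \<open>(1, S)\<close> exactly when \<open>S\<close>
  lies inside \<open>C\<close>. Shrinking \<open>K\<close> only adds requests, and the codewords
  that survive serve all earlier blocks.\<close>

definition code_requests :: "nat \<Rightarrow> slot set set \<Rightarrow> request set" where
  "code_requests k K = {r \<in> {0, 1} \<times> one_out_of k (k div 2). \<forall>C\<in>K. satisfies (code_config k C) r}"

lemma finite_code_requests: "finite (code_requests k K)"
proof (rule finite_subset)
  show "code_requests k K \<subseteq> {0, 1} \<times> Pow {1..k}"
    by (auto simp: code_requests_def one_out_of_def)
qed auto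

definition code_round :: "nat \<Rightarrow> slot set set \<Rightarrow> request list" where
  "code_round k K = (SOME rs. set rs = code_requests k K)"

lemma set_code_round: "set (code_round k K) = code_requests k K"
  unfolding code_round_def by (rule someI_ex) (rule finite_list[OF finite_code_requests])

text \<open>These are \<open>d\<close> repetitions of one round; the \<open>mod\<close> form lets
  the request at a given offset in a given round be read off directly.\<close>

definition code_block :: "nat \<Rightarrow> nat \<Rightarrow> slot set set \<Rightarrow> request list" where
  "code_block k d K =
    map (\<lambda>i. code_round k K ! (i mod length (code_round k K))) [0..<d * length (code_round k K)]"

lemma set_code_block: "set (code_block k d K) \<subseteq> code_requests k K"
proof -
  have "i mod length (code_round k K) < length (code_round k K)"
    if "i < d * length (code_round k K)" for i
    using that by (cases "code_round k K = []") auto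
  then show ?thesis
    by (auto simp: code_block_def simp flip: set_code_round intro!: nth_mem)
qed

section \<open>Deterministic algorithms against a constant-weight code\<close>

text \<open>As all codewords have equal size, the one-sided difference is half the Hamming distance.
  It bounds from below the retrievals of page 0 in a move from \<open>C'\<close> to
  \<open>C\<close>.\<close>

locale slot_code =
  fixes k d :: nat and code :: "slot set set"
  assumes fin: "finite code"
    and sub: "C \<in> code \<Longrightarrow> C \<subseteq> {1..k}"
    and card_code: "C \<in> code \<Longrightarrow> card C = k - k div 2"
    and dist: "C \<in> code \<Longrightarrow> C' \<in> code \<Longrightarrow> C \<noteq> C' \<Longrightarrow> d \<le> card (C - C')"
    and d3: "3 \<le> d" and k2: "2 \<le> k"
begin

lemma finite_codeword: "C \<in> code \<Longrightarrow> finite C"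
  using sub finite_subset by blast

text \<open>With m = \<open>k div 2\<close>, codewords have at most m + 1 elements, so sharing at
  least m - 1 leaves a difference of at most 2. This is where \<open>3 \<le> d\<close>
  enters.\<close>

lemma codeword_eqI:
  assumes "C \<in> code" "C' \<in> code" "U \<subseteq> C \<inter> C'" "k div 2 \<le> Suc (card U)"
  shows "C = C'"
proof (rule ccontr)
  assume "C \<noteq> C'"
  then have "d \<le> card (C - C')" using dist assms by blast
  moreover have "card C = card (C \<inter> C') + card (C - C')"
    using finite_codeword[OF assms(1)] by (metis card_Diff_subset_Int card_Int_Diff finite_Int)
  moreover have "card U \<le> card (C \<inter> C')"
    using finite_codeword[OF assms(1)] assms(3) by (intro card_mono) auto
  ultimately show False using card_code[OF assms(1)] assms(4) d3 by linarith
qed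

text \<open>The code distance forces a configuration that serves every request in \<open>code_requests k K\<close>
  to coincide with a codeword: if it held page 0 in too few (too many) slots, two \<open>m\<close>-sets
  differing in a single element would lie in the complements of (in) distinct codewords.\<close>

lemma slots_with_0_in_code:
  assumes K: "K \<subseteq> code" and c: "c \<in> configs k"
    and sat: "\<And>r. r \<in> code_requests k K \<Longrightarrow> satisfies c r"
  shows "slots_with_0 c \<in> K"
proof -
  define m where "m = k div 2"
  define Q where "Q = slots_with_0 c"
  have m1: "1 \<le> m" using k2 by (simp add: m_def)
  have Qsub: "Q \<subseteq> {1..k}"
    using c by (auto simp: Q_def slots_with_0_def configs_def)
  have finQ: "finite Q" using Qsub finite_subset by blast
  have cardQ: "card ({1..k} - Q) = k - card Q" using Qsub finQ by (simp add: card_Diff_subset)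
  \<comment> \<open>A request that \<open>c\<close> fails cannot belong to the round, so some
    codeword in \<open>K\<close> rules it out; \<open>ins\<close> is the same argument for page
    1.\<close>
  have out: "\<exists>C\<in>K. S \<inter> C = {}" if "S \<subseteq> {1..k} - Q" "card S = m" for S
  proof (rule ccontr)
    assume "\<not> ?thesis"
    then have "(0, S) \<in> code_requests k K"
      using that by (fastforce simp: code_requests_def one_out_of_def m_def code_config_def)
    then show False using sat that by (fastforce simp: Q_def slots_with_0_def)
  qed
  have ins: "\<exists>C\<in>K. S \<subseteq> C" if "S \<subseteq> Q" "card S = m" for S
  proof (rule ccontr)
    assume "\<not> ?thesis"
    then have "(1, S) \<in> code_requests k K"
      using that Qsub by (fastforce simp: code_requests_def one_out_of_def m_def code_config_def)
    then show False using sat that by (fastforce simp: Q_def slots_with_0_def)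
  qed
  consider "card Q = k - m" | "card Q < k - m" | "k - m < card Q" by linarith
  then have "Q \<in> K"
  proof cases
    case 1
    then have "card ({1..k} - Q) = m" using cardQ by (simp add: m_def)
    then obtain C where C: "C \<in> K" "({1..k} - Q) \<inter> C = {}" using out by blast
    then have "C \<subseteq> Q" using sub K by blast
    moreover have "card C = card Q" using C K card_code 1 by (auto simp: m_def)
    ultimately show ?thesis using C finQ by (metis card_subset_eq)
  next
    case 2
    then have "Suc m \<le> card ({1..k} - Q)" using cardQ by (simp add: m_def)
    \<comment> \<open>Each subset of \<open>T\<close> of size \<open>m\<close> is avoided by a
      codeword. Two such codewords avoid \<open>m - 1\<close> common slots and have complements of
      size \<open>m\<close>, so they are closer than \<open>d\<close> and coincide. The common
      codeword then avoids all of \<open>T\<close>, which exceeds its complement.\<close>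
    then obtain T where T: "T \<subseteq> {1..k} - Q" "card T = Suc m" by (meson obtain_subset_with_card_n)
    have finT: "finite T" using T by (metis card.infinite nat.distinct(1))
    have "\<exists>C\<in>K. (T - {s}) \<inter> C = {}" if "s \<in> T" for s
      using T that finT by (intro out) auto
    then obtain C where C: "\<And>s. s \<in> T \<Longrightarrow> C s \<in> K \<and> (T - {s}) \<inter> C s = {}" by metis
    obtain a b where ab: "a \<in> T" "b \<in> T" "a \<noteq> b"
      using T(2) m1 by (metis One_nat_def card_le_Suc0_iff_eq finT not_less_eq_eq)
    have Ca: "C a \<subseteq> {1..k}" "C a \<in> code" "C b \<subseteq> {1..k}" "C b \<in> code"
      using C ab K sub by blast+
    have "C a = C b"
    proof (rule ccontr)
      assume neq: "C a \<noteq> C b"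
      have "C a - C b \<subseteq> {1..k} - C b - (T - {a, b})" using C ab Ca by blast
      then have "card (C a - C b) \<le> card ({1..k} - C b - (T - {a, b}))" by (intro card_mono) auto
      also have "\<dots> = card ({1..k} - C b) - card (T - {a, b})"
        using C ab T by (intro card_Diff_subset) (auto simp: finT)
      also have "card ({1..k} - C b) = m"
        using Ca finite_codeword card_code by (simp add: card_Diff_subset m_def)
      also have "card (T - {a, b}) = m - 1"
        using ab finT T by (simp add: card_Diff_subset)
      finally have "card (C a - C b) \<le> m - (m - 1)" .
      then show False using dist[OF Ca(2,4) neq] d3 by linarith
    qed
    then have "T \<inter> C a = {}" using C ab by blast
    then have "T \<subseteq> {1..k} - C a" using T by blast
    then have "card T \<le> card ({1..k} - C a)" by (intro card_mono) auto
    also have "\<dots> = m" using Ca finite_codeword card_code by (simp add: card_Diff_subset m_def)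
    finally show ?thesis using T by simp
  next
    case 3
    then have "m \<le> card Q" by (simp add: m_def)
    then obtain U where U: "U \<subseteq> Q" "card U = m" by (meson obtain_subset_with_card_n)
    have finU: "finite U" using U finQ finite_subset by blast
    obtain C where C: "C \<in> K" "U \<subseteq> C" using ins U by blast
    have Cc: "C \<in> code" using C K by blast
    have "\<not> Q \<subseteq> C"
      using 3 card_mono[OF finite_codeword[OF Cc], of Q] card_code[OF Cc] by (auto simp: m_def)
    \<comment> \<open>Exchange argument: swapping some \<open>u\<close> in \<open>U\<close> for
      \<open>x\<close> gives another subset of \<open>Q\<close> of size \<open>m\<close>, contained
      in a codeword \<open>C'\<close>. As \<open>C\<close> and \<open>C'\<close> share
      \<open>U - {u}\<close>, they are equal, although only \<open>C'\<close> contains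
      \<open>x\<close>.\<close>
    then obtain x where x: "x \<in> Q" "x \<notin> C" by blast
    obtain u where u: "u \<in> U" using U m1 by fastforce
    have "x \<notin> U" using x C by blast
    then have "card (insert x (U - {u})) = m" using finU u U m1 by simp
    moreover have "insert x (U - {u}) \<subseteq> Q" using U x by blast
    ultimately obtain C' where C': "C' \<in> K" "insert x (U - {u}) \<subseteq> C'" using ins by blast
    have "C = C'"
      using C C' K U u finU by (intro codeword_eqI[of C C' "U - {u}"]) (auto simp: m_def)
    then show ?thesis using x C' by blast
  qed
  then show ?thesis by (simp add: Q_def)
qed

text \<open>An empty round would be served by the configuration holding no page, which would make
  the empty set a codeword.\<close>

lemma code_round_nonempty:
  assumes "K \<subseteq> code"
  shows "code_round k K \<noteq> []"
proof
  assume "code_round k K = []"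
  then have "code_requests k K = {}" using set_code_round[of k K] by simp
  then have "slots_with_0 (\<lambda>_. None) \<in> K"
    using assms by (intro slots_with_0_in_code) (auto simp: configs_def)
  then have "{} \<in> code" using assms by (auto simp: slots_with_0_def)
  from card_code[OF this] show False using k2 by simp
qed

text \<open>A round begun in a configuration outside \<open>K\<close> contains a request which that
  configuration fails, forcing a retrieval later in the same round. A block that never meets
  \<open>K\<close> thus costs a retrieval in each of its \<open>d\<close> rounds.\<close>

lemma block_visits_codeword:
  assumes sol: "is_solution k (\<tau> @ code_block k d K @ \<rho>) Cs" and K: "K \<subseteq> code"
    and cheap: "card {r \<in> retrievals Cs. length \<tau> \<le> fst r \<and>
      fst r < length \<tau> + length (code_block k d K)} < d"
  shows "\<exists>t. length \<tau> \<le> t \<and> t < length \<tau> + length (code_block k d K) \<and> slots_with_0 (Cs ! t) \<in> K"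
proof (rule ccontr)
  assume no: "\<not> ?thesis"
  define n where "n = length (code_round k K)"
  define i where "i = length \<tau>"
  have n0: "n > 0" using code_round_nonempty[OF K] by (simp add: n_def)
  have len: "length (code_block k d K) = d * n" by (simp add: code_block_def n_def)
  have lenCs: "length Cs = i + d * n + length \<rho>" using sol by (simp add: is_solution_def i_def len)
  have idx: "l * n + j < d * n" if "l < d" "j < n" for l j
  proof -
    have "l * n + j < Suc l * n" using that by simp
    also have "\<dots> \<le> d * n" using that by (intro mult_le_mono1) simp
    finally show ?thesis .
  qed
  have req: "satisfies (Cs ! (i + (l * n + j))) (code_round k K ! j)" if "l < d" "j < n" for l j
  proof -
    have "i + (l * n + j) < length (\<tau> @ code_block k d K @ \<rho>)"
      using idx[OF that] by (simp add: i_def len)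
    then have "satisfies (Cs ! (i + (l * n + j))) ((\<tau> @ code_block k d K @ \<rho>) ! (i + (l * n + j)))"
      using sol unfolding is_solution_def by blast
    also have "(\<tau> @ code_block k d K @ \<rho>) ! (i + (l * n + j)) = code_round k K ! j"
      using idx[OF that] that by (simp add: i_def nth_append len) (simp add: code_block_def n_def)
    finally show ?thesis .
  qed
  have ex: "\<exists>r\<in>retrievals Cs. i + l * n < fst r \<and> fst r < i + l * n + n" if l: "l < d" for l
  proof -
    have ini: "i + l * n < length Cs" using idx[OF l n0] lenCs by linarith
    have "slots_with_0 (Cs ! (i + l * n)) \<notin> K"
      using no idx[OF l n0] by (auto simp: i_def len)
    moreover have "Cs ! (i + l * n) \<in> configs k"
      using sol nth_mem[OF ini] by (auto simp: is_solution_def)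
    ultimately obtain r where r: "r \<in> code_requests k K" "\<not> satisfies (Cs ! (i + l * n)) r"
      using slots_with_0_in_code[OF K] by blast
    then obtain j where j: "j < n" "r = code_round k K ! j"
      by (metis in_set_conv_nth n_def set_code_round)
    obtain p S where pS: "r = (p, S)" by (cases r)
    have "satisfies (Cs ! (i + (l * n + j))) (p, S)" using req[OF l j(1)] j pS by simp
    then obtain s where s: "s \<in> S" "(Cs ! (i + (l * n + j))) s = Some p" by auto
    then have s0: "(Cs ! (i + l * n)) s \<noteq> Some p" using r pS by auto
    \<comment> \<open>The starting configuration serves the first request of its round, so the
      failed request comes strictly later.\<close>
    then have "j \<noteq> 0" using s by (intro notI) simp
    then obtain u where "i + l * n < u" "u \<le> i + (l * n + j)" "(u, s, p) \<in> retrievals Cs"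
      using ex_retrieval_between[OF _ _ s0 s(2)] idx[OF l j(1)] lenCs by auto
    then show ?thesis using j by (intro bexI[of _ "(u, s, p)"]) auto
  qed
  then obtain r where r: "\<And>l. l < d \<Longrightarrow>
      r l \<in> retrievals Cs \<and> i + l * n < fst (r l) \<and> fst (r l) < i + l * n + n"
    by metis
  \<comment> \<open>Division by \<open>n\<close> recovers the round from the retrieval time, so
    different rounds give different retrievals.\<close>
  have "inj_on r {..<d}"
  proof (rule inj_onI)
    fix l l' assume "l \<in> {..<d}" "l' \<in> {..<d}" "r l = r l'"
    then have "(fst (r l) - i) div n = l" "(fst (r l) - i) div n = l'"
      using r[of l] r[of l'] n0 by (auto intro!: div_nat_eqI simp: mult.commute)
    then show "l = l'" by simp
  qed
  moreover have "r ` {..<d} \<subseteq>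
      {r \<in> retrievals Cs. length \<tau> \<le> fst r \<and> fst r < length \<tau> + length (code_block k d K)}"
  proof
    fix y assume "y \<in> r ` {..<d}"
    then obtain l where l: "l < d" "y = r l" by auto
    have "l * n + n \<le> d * n" using l mult_le_mono1[of "Suc l" d n] by simp
    then show "y \<in> {r \<in> retrievals Cs. length \<tau> \<le> fst r \<and> fst r < length \<tau> + length (code_block k d K)}"
      using r[OF l(1)] l by (auto simp: len i_def)
  qed
  moreover have "finite (retrievals Cs)"
    using sol finite_retrievals unfolding is_solution_def by blast
  ultimately have "card {..<d} \<le> card {r \<in> retrievals Cs. length \<tau> \<le> fst r \<and>
      fst r < length \<tau> + length (code_block k d K)}"
    by (intro card_inj_on_le) auto
  then show False using cheap by simp
qed

lemma code_block_request_seqs: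
  "code_block k d K \<in> request_seqs (one_out_of k (k div 2))"
  using set_code_block[of k d K]
  by (auto simp: request_seqs_def lists_eq_set code_requests_def)

text \<open>Unless the first block already costs \<open>d\<close>, the algorithm visits a codeword
  \<open>x\<close> in it. With \<open>x\<close> removed, the second block either costs
  \<open>d\<close> by itself or forces a visit to another codeword, at distance at least
  \<open>d\<close> from \<open>x\<close>.\<close>

lemma two_blocks_expensive:
  assumes A: "correct_alg k (one_out_of k (k div 2)) A"
    and \<tau>: "\<tau> \<in> request_seqs (one_out_of k (k div 2))"
    and K: "K \<subseteq> code" "K \<noteq> {}"
  shows "\<exists>x\<in>K. cost (run A \<tau>) + d
    \<le> cost (run A (\<tau> @ code_block k d K @ code_block k d (K - {x})))"
proof -
  let ?B = "code_block k d"
  have sol: "is_solution k \<sigma> (run A \<sigma>)" if "\<sigma> \<in> request_seqs (one_out_of k (k div 2))" for \<sigma>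
    using A that by (simp add: correct_alg_def)
  have seq1: "\<tau> @ ?B K \<in> request_seqs (one_out_of k (k div 2))"
    using \<tau> code_block_request_seqs[of K] by (simp add: request_seqs_def)
  have seq2: "\<tau> @ ?B K @ ?B K' \<in> request_seqs (one_out_of k (k div 2))" for K'
    using \<tau> code_block_request_seqs[of K] code_block_request_seqs[of K']
    by (simp add: request_seqs_def)
  show ?thesis
  proof (cases "cost (run A \<tau>) + d \<le> cost (run A (\<tau> @ ?B K))")
    case True
    obtain x where "x \<in> K" using K by blast
    moreover have "cost (run A (\<tau> @ ?B K)) \<le> cost (run A (\<tau> @ ?B K @ ?B (K - {x})))"
      using cost_run_append[of k "\<tau> @ ?B K" "?B (K - {x})" A] sol[OF seq2] by simp
    ultimately show ?thesis using True le_trans by blast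
  next
    case False
    have "card {r \<in> retrievals (run A (\<tau> @ ?B K)). length \<tau> \<le> fst r} < d"
      using False cost_run_append[OF sol[OF seq1]] by simp
    moreover have "{r \<in> retrievals (run A (\<tau> @ ?B K)). length \<tau> \<le> fst r \<and>
        fst r < length \<tau> + length (?B K)}
      = {r \<in> retrievals (run A (\<tau> @ ?B K)). length \<tau> \<le> fst r}"
      by (auto simp: retrievals_def)
    ultimately obtain t where t: "length \<tau> \<le> t" "t < length \<tau> + length (?B K)"
        "slots_with_0 (run A (\<tau> @ ?B K) ! t) \<in> K"
      using block_visits_codeword[of \<tau> K "[]" "run A (\<tau> @ ?B K)"] sol[OF seq1] K by auto
    define x where "x = slots_with_0 (run A (\<tau> @ ?B K) ! t)"
    define Cs where "Cs = run A (\<tau> @ ?B K @ ?B (K - {x}))"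
    have solCs: "is_solution k (\<tau> @ ?B K @ ?B (K - {x})) Cs"
      using sol[OF seq2] by (simp add: Cs_def)
    have conf: "set Cs \<subseteq> configs k" using solCs by (simp add: is_solution_def)
    have finC: "finite (retrievals Cs)" by (rule finite_retrievals[OF conf])
    \<comment> \<open>\<open>x\<close> was read off the run on the first block alone; the algorithm
      is online, so it visits \<open>x\<close> at the same time whatever block follows.\<close>
    have x: "slots_with_0 (Cs ! t) = x"
    proof -
      have "Cs = run A (\<tau> @ ?B K) @ drop (length (\<tau> @ ?B K)) Cs"
        using run_append[of A "\<tau> @ ?B K" "?B (K - {x})"] by (simp add: Cs_def)
      then have "Cs ! t = run A (\<tau> @ ?B K) ! t"
        using t by (metis length_append length_run nth_append)
      then show ?thesis by (simp add: x_def)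
    qed
    have "d \<le> card {r \<in> retrievals Cs. length \<tau> \<le> fst r}"
    proof (rule ccontr)
      assume "\<not> ?thesis"
      then have less: "card {r \<in> retrievals Cs. length \<tau> \<le> fst r} < d" by simp
      have "card {r \<in> retrievals Cs. length (\<tau> @ ?B K) \<le> fst r \<and>
          fst r < length (\<tau> @ ?B K) + length (?B (K - {x}))}
        \<le> card {r \<in> retrievals Cs. length \<tau> \<le> fst r}"
        using finC by (intro card_mono) auto
      then have "card {r \<in> retrievals Cs. length (\<tau> @ ?B K) \<le> fst r \<and>
          fst r < length (\<tau> @ ?B K) + length (?B (K - {x}))} < d"
        using less by linarith
      then obtain t' where t': "length (\<tau> @ ?B K) \<le> t'"
          "t' < length (\<tau> @ ?B K) + length (?B (K - {x}))" "slots_with_0 (Cs ! t') \<in> K - {x}"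
        using block_visits_codeword[of "\<tau> @ ?B K" "K - {x}" "[]" Cs] solCs K by auto
      have "length Cs = length (\<tau> @ ?B K) + length (?B (K - {x}))" by (simp add: Cs_def)
      then have "card (slots_with_0 (Cs ! t') - slots_with_0 (Cs ! t))
          \<le> card {r \<in> retrievals Cs. t < fst r \<and> fst r \<le> t'}"
        using t t' unfolding slots_with_0_def by (intro card_retrievals_between[OF conf]) auto
      also have "\<dots> \<le> card {r \<in> retrievals Cs. length \<tau> \<le> fst r}"
        using finC t by (intro card_mono) auto
      finally have "card (slots_with_0 (Cs ! t') - slots_with_0 (Cs ! t)) < d" using less by linarith
      moreover have "slots_with_0 (Cs ! t') \<in> code" "slots_with_0 (Cs ! t) \<in> code"
          "slots_with_0 (Cs ! t') \<noteq> slots_with_0 (Cs ! t)"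
        using t' t K x x_def by auto
      ultimately show False using dist by fastforce
    qed
    then have "cost (run A \<tau>) + d \<le> cost Cs"
      using cost_run_append[OF sol[OF seq2]] by (simp add: Cs_def)
    moreover have "x \<in> K" using t by (simp add: x_def)
    ultimately show ?thesis by (auto simp: Cs_def)
  qed
qed

end

section \<open>Averaging over a randomized algorithm, and repeated phases\<close>

locale slot_code_adversary = slot_code +
  fixes M
  assumes alg: "randomized_alg k (one_out_of k (k div 2)) M"
begin

abbreviation "seqs \<equiv> request_seqs (one_out_of k (k div 2))"

lemma correct_AE: "AE A in M. correct_alg k (one_out_of k (k div 2)) A"
  using alg by (simp add: randomized_alg_def)

lemma integrable_cost [simp]: "integrable M (\<lambda>A. real (cost (run A \<sigma>)))"
  using integrable_cost_run[OF alg] .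

lemma cost_run_append_mono:
  assumes "correct_alg k (one_out_of k (k div 2)) A" "\<tau> @ \<rho> \<in> seqs"
  shows "cost (run A \<tau>) \<le> cost (run A (\<tau> @ \<rho>))"
  using cost_run_append[of k \<tau> \<rho> A] assms by (simp add: correct_alg_def)

lemma expected_cost_mono:
  assumes "\<tau> @ \<rho> \<in> seqs"
  shows "expected_cost M \<tau> \<le> expected_cost M (\<tau> @ \<rho>)"
  unfolding expected_cost_def
  by (rule integral_mono_AE)
     (use correct_AE cost_run_append_mono[OF _ assms] in \<open>auto elim!: eventually_mono\<close>)

text \<open>For each correct deterministic algorithm the extra costs over all choices of
  \<open>y\<close> sum to at least \<open>d\<close>: one choice costs \<open>d\<close> and none is
  negative. In expectation some \<open>y\<close> reaches the average.\<close>

lemma expected_cost_two_blocks: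
  assumes \<tau>: "\<tau> \<in> seqs" and K: "K \<subseteq> code" "K \<noteq> {}"
  shows "\<exists>y\<in>K. expected_cost M \<tau> + real d / real (card K)
    \<le> expected_cost M (\<tau> @ code_block k d K @ code_block k d (K - {y}))"
proof (rule ccontr)
  assume no: "\<not> ?thesis"
  let ?\<sigma> = "\<lambda>y. \<tau> @ code_block k d K @ code_block k d (K - {y})"
  interpret prob_space M using alg by (simp add: randomized_alg_def)
  have finK: "finite K" using K fin finite_subset by blast
  have seq: "?\<sigma> y \<in> seqs" for y
    using \<tau> code_block_request_seqs[of K] code_block_request_seqs[of "K - {y}"]
    by (simp add: request_seqs_def)
  have "AE A in M. real d \<le> (\<Sum>y\<in>K. real (cost (run A (?\<sigma> y))) - real (cost (run A \<tau>)))"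
    using correct_AE
  proof (rule eventually_mono)
    fix A assume A: "correct_alg k (one_out_of k (k div 2)) A"
    obtain x where x: "x \<in> K" "cost (run A \<tau>) + d \<le> cost (run A (?\<sigma> x))"
      using two_blocks_expensive[OF A \<tau> K] by blast
    have "real d \<le> real (cost (run A (?\<sigma> x))) - real (cost (run A \<tau>))" using x by simp
    also have "\<dots> \<le> (\<Sum>y\<in>K. real (cost (run A (?\<sigma> y))) - real (cost (run A \<tau>)))"
      using cost_run_append_mono[OF A seq]
      by (intro member_le_sum[where f = "\<lambda>y. real (cost (run A (?\<sigma> y))) - real (cost (run A \<tau>))"])
         (auto simp: x finK)
    finally show "real d \<le> (\<Sum>y\<in>K. real (cost (run A (?\<sigma> y))) - real (cost (run A \<tau>)))" .
  qed
  then have "(\<integral>A. real d \<partial>M)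
      \<le> (\<integral>A. (\<Sum>y\<in>K. real (cost (run A (?\<sigma> y))) - real (cost (run A \<tau>))) \<partial>M)"
    by (intro integral_mono_AE) auto
  also have "\<dots> = (\<Sum>y\<in>K. expected_cost M (?\<sigma> y) - expected_cost M \<tau>)"
    by (simp add: expected_cost_def del: sum_subtractf)
  also have "\<dots> < (\<Sum>y\<in>K. real d / real (card K))"
    using no K finK by (intro sum_strict_mono) (auto simp: not_le algebra_simps)
  also have "\<dots> = real d" using K finK by simp
  finally show False by (simp add: prob_space)
qed

text \<open>Charging each step to two consecutive blocks makes the sum telescope to twice the cost
  of the phase.\<close>

lemma phase_from:
  assumes "\<tau> \<in> seqs" "K \<subseteq> code" "card K = Suc n"
  shows "\<exists>\<rho> x. x \<in> K \<and> \<rho> \<in> seqs \<and>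
    (\<forall>r\<in>set (code_block k d K @ \<rho>). satisfies (code_config k x) r) \<and>
    expected_cost M \<tau> + expected_cost M (\<tau> @ code_block k d K) + real d * (harm (Suc n) - 1)
      \<le> 2 * expected_cost M (\<tau> @ code_block k d K @ \<rho>)"
  using assms
proof (induction n arbitrary: \<tau> K)
  \<comment> \<open>Here \<open>harm 1 - 1 = 0\<close>, so monotonicity of the expected cost
    suffices.\<close>
  case 0
  then obtain x where x: "K = {x}" by (metis One_nat_def card_1_singletonE)
  have "\<forall>r\<in>set (code_block k d K). satisfies (code_config k x) r"
    using set_code_block[of k d K] by (auto simp: x code_requests_def)
  moreover have "expected_cost M \<tau> \<le> expected_cost M (\<tau> @ code_block k d K)"
    using 0 code_block_request_seqs[of K] by (intro expected_cost_mono) (simp add: request_seqs_def)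
  ultimately show ?case
    by (intro exI[of _ "[]"] exI[of _ x]) (auto simp: x request_seqs_def harm_def)
next
  case (Suc n)
  let ?B = "code_block k d"
  have "K \<noteq> {}" using Suc.prems by auto
  then obtain y where y: "y \<in> K" "expected_cost M \<tau> + real d / real (card K)
      \<le> expected_cost M (\<tau> @ ?B K @ ?B (K - {y}))"
    using expected_cost_two_blocks Suc.prems by blast
  \<comment> \<open>The induction hypothesis is applied one block on. Its second summand then lies
    two blocks after \<open>\<tau>\<close>, where the choice of \<open>y\<close> has gained
    \<open>d / card K\<close> over \<open>expected_cost M \<tau>\<close>.\<close>
  have "\<tau> @ ?B K \<in> seqs"
    using Suc.prems code_block_request_seqs[of K] by (simp add: request_seqs_def)
  moreover have "card (K - {y}) = Suc n" using y Suc.prems by simp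
  ultimately obtain \<rho> x where \<rho>: "x \<in> K - {y}" "\<rho> \<in> seqs"
    "\<forall>r\<in>set (?B (K - {y}) @ \<rho>). satisfies (code_config k x) r"
    "expected_cost M (\<tau> @ ?B K) + expected_cost M ((\<tau> @ ?B K) @ ?B (K - {y}))
        + real d * (harm (Suc n) - 1)
      \<le> 2 * expected_cost M ((\<tau> @ ?B K) @ ?B (K - {y}) @ \<rho>)"
    using Suc.IH[of "\<tau> @ ?B K" "K - {y}"] Suc.prems by blast
  have "\<forall>r\<in>set (?B K). satisfies (code_config k x) r"
    using set_code_block[of k d K] \<rho>(1) by (auto simp: code_requests_def)
  moreover have "?B (K - {y}) @ \<rho> \<in> seqs"
    using \<rho>(2) code_block_request_seqs[of "K - {y}"] by (simp add: request_seqs_def)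
  moreover have "real d * (harm (Suc (Suc n)) - 1)
      = real d * (harm (Suc n) - 1) + real d / real (card K)"
    using Suc.prems by (simp add: harm_Suc[of "Suc n"] field_simps del: of_nat_Suc)
  ultimately show ?case
    using \<rho> y(2) by (intro exI[of _ "?B (K - {y}) @ \<rho>"] exI[of _ x]) auto
qed

text \<open>In each phase the offline solution moves once, for at most \<open>k\<close>, to the
  configuration of the last surviving codeword and stays there.\<close>

lemma phases:
  assumes "code \<noteq> {}"
  shows "\<exists>\<sigma> Cs. \<sigma> \<in> seqs \<and> is_solution k \<sigma> Cs \<and> cost Cs \<le> n * k \<and>
    real n * (real d * (harm (card code) - 1) / 2) \<le> expected_cost M \<sigma>"
proof (induction n)
  case 0
  show ?case
    by (intro exI[of _ "[]"])
       (auto simp: request_seqs_def is_solution_def cost_def retrievals_def expected_cost_def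
         case_prod_unfold)
next
  case (Suc n)
  then obtain \<sigma> Cs where \<sigma>: "\<sigma> \<in> seqs" "is_solution k \<sigma> Cs" "cost Cs \<le> n * k"
    "real n * (real d * (harm (card code) - 1) / 2) \<le> expected_cost M \<sigma>" by blast
  let ?B = "code_block k d code"
  obtain N where N: "card code = Suc N"
    using assms fin by (metis card_0_eq not0_implies_Suc)
  obtain \<rho> x where \<rho>: "\<rho> \<in> seqs" "\<forall>r\<in>set (?B @ \<rho>). satisfies (code_config k x) r"
    "expected_cost M \<sigma> + expected_cost M (\<sigma> @ ?B) + real d * (harm (Suc N) - 1)
      \<le> 2 * expected_cost M (\<sigma> @ ?B @ \<rho>)"
    using phase_from[OF \<sigma>(1) subset_refl N] by blast
  have seq: "\<sigma> @ ?B @ \<rho> \<in> seqs"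
    using \<sigma>(1) \<rho>(1) code_block_request_seqs[of code] by (simp add: request_seqs_def)
  \<comment> \<open>This makes both cost terms on the left of the phase bound at least
    \<open>expected_cost M \<sigma>\<close>; the factor 2 on its right is the source of the division
    by 2.\<close>
  have "expected_cost M \<sigma> \<le> expected_cost M (\<sigma> @ ?B)"
    using \<sigma>(1) code_block_request_seqs[of code]
    by (intro expected_cost_mono) (simp add: request_seqs_def)
  then have "real (Suc n) * (real d * (harm (card code) - 1) / 2) \<le> expected_cost M (\<sigma> @ ?B @ \<rho>)"
    using \<rho>(3) \<sigma>(4) N by (simp add: algebra_simps)
  moreover have "cost (Cs @ replicate (length (?B @ \<rho>)) (code_config k x)) \<le> Suc n * k"
    using cost_append_replicate[of Cs k "code_config k x"] \<sigma> code_config_in_configs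
    by (fastforce simp: is_solution_def intro: order_trans)
  moreover have "is_solution k (\<sigma> @ ?B @ \<rho>)
      (Cs @ replicate (length (?B @ \<rho>)) (code_config k x))"
    unfolding is_solution_def
  proof (intro conjI allI impI)
    show "set (Cs @ replicate (length (?B @ \<rho>)) (code_config k x)) \<subseteq> configs k"
      using \<sigma>(2) code_config_in_configs by (auto simp: is_solution_def)
    fix t assume t: "t < length (\<sigma> @ ?B @ \<rho>)"
    have len: "length Cs = length \<sigma>" using \<sigma>(2) by (simp add: is_solution_def)
    show "satisfies ((Cs @ replicate (length (?B @ \<rho>)) (code_config k x)) ! t)
        ((\<sigma> @ ?B @ \<rho>) ! t)"
    proof (cases "t < length \<sigma>")
      case True
      then show ?thesis using \<sigma>(2) by (simp add: is_solution_def nth_append)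
    next
      case False
      then have "(?B @ \<rho>) ! (t - length \<sigma>) \<in> set (?B @ \<rho>)" using t by (intro nth_mem) simp
      then have "satisfies (code_config k x) ((?B @ \<rho>) ! (t - length \<sigma>))" using \<rho>(2) by blast
      moreover have "(Cs @ replicate (length (?B @ \<rho>)) (code_config k x)) ! t = code_config k x"
        using False t len by (simp add: nth_append[of Cs])
      moreover have "(\<sigma> @ ?B @ \<rho>) ! t = (?B @ \<rho>) ! (t - length \<sigma>)"
        using False by (simp add: nth_append[of \<sigma>])
      ultimately show ?thesis by simp
    qed
  qed (use \<sigma>(2) in \<open>simp add: is_solution_def\<close>)
  ultimately show ?case using seq by blast
qed

text \<open>Both costs are compared over \<open>n\<close> phases; as \<open>n\<close> grows, the
  additive constant \<open>b\<close> becomes negligible.\<close>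

lemma competitive_lower_bound:
  assumes two: "2 \<le> card code" and comp: "competitive k (one_out_of k (k div 2)) c M"
  shows "real d * (harm (card code) - 1) / (2 * real k) \<le> c"
proof -
  define a where "a = real d * (harm (card code) - 1) / 2"
  obtain b where b: "\<And>\<sigma>. \<sigma> \<in> seqs \<Longrightarrow> expected_cost M \<sigma> \<le> c * real (opt_cost k \<sigma>) + b"
    using comp by (auto simp: competitive_def)
  have k0: "real k > 0" using k2 by simp
  have "code \<noteq> {}" using two by auto
  have "a > 0"
  proof -
    have "(harm 2 :: real) \<le> harm (card code)" using two by (rule harm_mono)
    then have "harm (card code) > (1 :: real)" by (simp add: harm_def numeral_2_eq_2)
    then show ?thesis using d3 by (simp add: a_def)
  qed
  \<comment> \<open>For negative \<open>c\<close> an upper bound on \<open>opt_cost\<close> would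
    not bound the product from above, hence \<open>max c 0\<close>; positivity of \<open>a\<close>
    brings back \<open>c\<close> at the end.\<close>
  have main: "real n * a \<le> max c 0 * (real n * real k) + b" for n
  proof -
    obtain \<sigma> Cs where \<sigma>: "\<sigma> \<in> seqs" "is_solution k \<sigma> Cs" "cost Cs \<le> n * k"
      "real n * a \<le> expected_cost M \<sigma>"
      using phases[OF \<open>code \<noteq> {}\<close>, of n] by (auto simp: a_def)
    have "opt_cost k \<sigma> \<le> cost Cs"
      unfolding opt_cost_def by (rule cInf_lower) (use \<sigma>(2) in auto)
    then have o: "real (opt_cost k \<sigma>) \<le> real n * real k" using \<sigma>(3)
      by (metis le_trans of_nat_le_iff of_nat_mult)
    have "c * real (opt_cost k \<sigma>) \<le> max c 0 * real (opt_cost k \<sigma>)"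
      by (intro mult_right_mono) auto
    also have "\<dots> \<le> max c 0 * (real n * real k)" using o by (intro mult_left_mono) auto
    finally show ?thesis using b[OF \<sigma>(1)] \<sigma>(4) by linarith
  qed
  have "a \<le> max c 0 * real k"
  proof (rule ccontr)
    assume "\<not> ?thesis"
    then have pos: "a - max c 0 * real k > 0" by simp
    obtain n :: nat where "b < real n * (a - max c 0 * real k)"
      using reals_Archimedean3[OF pos] by blast
    then show False using main[of n] by (simp add: algebra_simps)
  qed
  then have "a / real k \<le> max c 0" using k0 by (simp add: field_simps)
  moreover have "a / real k > 0" using \<open>a > 0\<close> k0 by simp
  ultimately have "a / real k \<le> c" by linarith
  then show ?thesis by (simp add: a_def)
qed

end

section \<open>Existence of large codes\<close>

text \<open>A Chernoff-style bound: weighting each set by \<open>(1 / 4) ^ card Z\<close> bounds the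
  count by \<open>4 ^ d\<close> times the generating function
  \<open>(1 + 1 / 4) ^ n\<close>.\<close>

lemma card_small_subsets_le:
  fixes n d :: nat
  assumes "8 * d \<le> n"
  shows "real (card {Z. Z \<subseteq> {1..n} \<and> card Z < d}) \<le> (5 / 3) ^ n"
proof -
  let ?B = "{Z. Z \<subseteq> {1..n} \<and> card Z < d}"
  have "real (card ?B) * (1 / 4) ^ d = (\<Sum>Z\<in>?B. (1 / 4) ^ d)" by simp
  also have "\<dots> \<le> (\<Sum>Z\<in>?B. (1 / 4) ^ card Z)"
    by (intro sum_mono power_decreasing) auto
  also have "\<dots> \<le> (\<Sum>Z\<in>Pow {1..n}. (1 / 4) ^ card Z)"
    by (intro sum_mono2) auto
  also have "\<dots> = (\<Prod>i\<in>{1..n}. (1 / 4 :: real) + 1)"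
    by (subst prod_add) auto
  also have "\<dots> = (5 / 4) ^ n" by simp
  finally have "real (card ?B) \<le> (5 / 4) ^ n * 4 ^ d"
    by (simp add: field_simps power_divide)
  \<comment> \<open>Since \<open>4 \<le> (4 / 3) ^ 8\<close> and \<open>8 * d \<le> n\<close>, the
    factor \<open>4 ^ d\<close> only raises the base from 5/4 to 5/4 * 4/3 = 5/3.\<close>
  also have "(4 :: real) ^ d \<le> ((4 / 3) ^ 8) ^ d" by (intro power_mono) (auto simp: power_divide)
  also have "((4 / 3 :: real) ^ 8) ^ d \<le> (4 / 3) ^ n"
    using assms by (simp flip: power_mult)
  also have "(5 / 4 :: real) ^ n * (4 / 3) ^ n = (5 / 3) ^ n"
    by (simp flip: power_mult_distrib)
  finally show ?thesis by simp
qed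

text \<open>In a code of largest size every word is closer than \<open>d\<close> to some codeword,
  as it could be added otherwise. The balls around the codewords cover the cube, and 2 / (5/3) =
  6/5.\<close>

lemma gilbert_varshamov:
  fixes n d :: nat
  assumes "0 < d" "8 * d \<le> n"
  obtains X where "X \<subseteq> Pow {1..n}" "(6 / 5) ^ n \<le> real (card X)"
    "\<And>x y. x \<in> X \<Longrightarrow> y \<in> X \<Longrightarrow> x \<noteq> y \<Longrightarrow> d \<le> card (sym_diff x y)"
proof -
  define codes where "codes = {X. X \<subseteq> Pow {1..n} \<and>
    (\<forall>x\<in>X. \<forall>y\<in>X. x \<noteq> y \<longrightarrow> d \<le> card (sym_diff x y))}"
  have "finite codes"
    by (rule finite_subset[of _ "Pow (Pow {1..n})"]) (auto simp: codes_def)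
  moreover have "{} \<in> codes" by (auto simp: codes_def)
  ultimately obtain X where X: "X \<in> codes" and max: "\<And>Y. Y \<in> codes \<Longrightarrow> card Y \<le> card X"
    using Max_in[of "card ` codes"] Max_ge[of "card ` codes"] by fastforce
  have finX: "finite X" using X by (auto simp: codes_def intro: finite_subset)
  let ?B = "{Z. Z \<subseteq> {1..n} \<and> card Z < d}"
  have "Pow {1..n} \<subseteq> (\<lambda>(x, Z). sym_diff x Z) ` (X \<times> ?B)"
  proof
    fix y :: "nat set" assume y: "y \<in> Pow {1..n}"
    have "\<exists>x\<in>X. sym_diff x y \<in> ?B"
    proof (cases "y \<in> X")
      case True
      then show ?thesis using assms by (intro bexI[of _ y]) auto
    next
      case False
      show ?thesis
      proof (rule ccontr)
        assume no: "\<not> ?thesis"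
        have far: "d \<le> card (sym_diff x y)" if "x \<in> X" for x
          using no that y X by (fastforce simp: codes_def)
        have "insert y X \<in> codes"
          using X y far by (auto simp: codes_def Un_commute)
        then have "card (insert y X) \<le> card X" by (rule max)
        then show False using False finX by simp
      qed
    qed
    then obtain x where x: "x \<in> X" "sym_diff x y \<in> ?B" by blast
    moreover have "y = sym_diff x (sym_diff x y)" by blast
    ultimately show "y \<in> (\<lambda>(x, Z). sym_diff x Z) ` (X \<times> ?B)"
      by (intro image_eqI[of _ _ "(x, sym_diff x y)"]) auto
  qed
  then have "card (Pow {1..n}) \<le> card (X \<times> ?B)"
    using finX by (intro surj_card_le) auto
  then have "2 ^ n \<le> card X * card ?B" by (simp add: card_Pow card_cartesian_product)
  then have "(2 :: real) ^ n \<le> real (card X) * real (card ?B)"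
    by (metis of_nat_le_iff of_nat_mult of_nat_numeral of_nat_power)
  also have "\<dots> \<le> real (card X) * (5 / 3) ^ n"
    using card_small_subsets_le[OF assms(2)] by (intro mult_left_mono) auto
  finally have "(2 :: real) ^ n / (5 / 3) ^ n \<le> real (card X)" by (simp add: field_simps)
  then have "(6 / 5) ^ n \<le> real (card X)" by (simp flip: power_divide)
  moreover have "X \<subseteq> Pow {1..n}" using X by (simp add: codes_def)
  moreover have "d \<le> card (sym_diff x y)" if "x \<in> X" "y \<in> X" "x \<noteq> y" for x y
    using X that by (simp add: codes_def)
  ultimately show ?thesis using that by metis
qed

lemma ex_slot_code:
  assumes "3 \<le> d" "8 * d \<le> k div 2"
  shows "\<exists>code. slot_code k d code \<and> (6 / 5) ^ (k div 2) \<le> real (card code)"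
proof -
  define n where "n = k div 2"
  have "0 < d" using assms(1) by simp
  then obtain X where X: "X \<subseteq> Pow {1..n}" "(6 / 5) ^ n \<le> real (card X)"
    "\<And>x y. x \<in> X \<Longrightarrow> y \<in> X \<Longrightarrow> x \<noteq> y \<Longrightarrow> d \<le> card (sym_diff x y)"
    using gilbert_varshamov[OF _ assms(2)[folded n_def]] by metis
  \<comment> \<open>Appending the complement of a word makes all weights equal and preserves the distance.\<close>
  define w where "w x = x \<union> (+) n ` ({1..n} - x) \<union> {2 * n<..k}" for x
  have nk: "2 * n \<le> k" by (simp add: n_def)
  have w_low: "w x \<inter> {1..n} = x" if "x \<subseteq> {1..n}" for x
    using that nk by (auto simp: w_def)
  have disj: "x \<inter> (+) n ` Z = {}" if "x \<subseteq> {1..n}" "Z \<subseteq> {1..n}" for x Z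
    using that by fastforce
  have diff: "card (w x - w y) = card (sym_diff x y)" if "x \<subseteq> {1..n}" "y \<subseteq> {1..n}" for x y
  proof -
    have fin: "finite x" "finite y" using that finite_subset by blast+
    \<comment> \<open>The complemented half contributes the reverse difference \<open>y - x\<close>,
      so the one-sided difference of the new words has the size of the full symmetric
      difference.\<close>
    have "w x - w y = (x - y) \<union> (+) n ` (y - x)"
    proof (rule set_eqI)
      fix s
      have low: "s \<notin> (+) n ` Z" if "s \<le> n" "Z \<subseteq> {1..n}" for Z using that by auto
      have high: "s \<in> (+) n ` Z \<longleftrightarrow> s - n \<in> Z" if "n < s" for Z
        using that by (auto intro!: image_eqI[of _ _ "s - n"])
      have bounded: "s \<in> Z \<Longrightarrow> s \<le> n" "s - n \<in> Z \<Longrightarrow> s \<le> 2 * n" if "Z \<subseteq> {1..n}" for Z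
        using that by fastforce+
      show "s \<in> w x - w y \<longleftrightarrow> s \<in> (x - y) \<union> (+) n ` (y - x)"
      proof (cases "s \<le> n")
        case True
        have "s \<notin> (+) n ` ({1..n} - x)" "s \<notin> (+) n ` ({1..n} - y)" "s \<notin> (+) n ` (y - x)"
          using that by (intro low[OF True]; blast)+
        then show ?thesis using True by (auto simp: w_def)
      next
        case False
        have "s \<notin> x" "s \<notin> y" using bounded(1) that False by blast+
        moreover have "s \<le> 2 * n" if "s - n \<in> y" using bounded(2) that \<open>y \<subseteq> {1..n}\<close> by blast
        ultimately show ?thesis using False that(2) by (auto simp: w_def high)
      qed
    qed
    moreover have "card ((x - y) \<union> (+) n ` (y - x)) = card (x - y) + card ((+) n ` (y - x))"
      using that fin disj[of "x - y" "y - x"] by (intro card_Un_disjoint) auto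
    moreover have "card (sym_diff x y) = card (x - y) + card (y - x)"
      using fin by (intro card_Un_disjoint) auto
    ultimately show ?thesis by (simp add: card_image)
  qed
  \<comment> \<open>The two halves together hold \<open>n\<close> slots; \<open>{2 * n<..k}\<close>,
    which is \<open>{k}\<close> for odd \<open>k\<close> and empty for even \<open>k\<close>,
    supplies the other \<open>k - 2 * n\<close>.\<close>
  have card_w: "card (w x) = k - k div 2" if "x \<subseteq> {1..n}" for x
  proof -
    have fin: "finite x" using that finite_subset by blast
    have "card (w x) = card (x \<union> (+) n ` ({1..n} - x)) + card {2 * n<..k}"
      unfolding w_def using that fin by (intro card_Un_disjoint) auto
    also have "card (x \<union> (+) n ` ({1..n} - x)) = card x + card ((+) n ` ({1..n} - x))"
      using that fin disj[of x "{1..n} - x"] by (intro card_Un_disjoint) auto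
    also have "card ((+) n ` ({1..n} - x)) = n - card x"
      using that fin by (simp add: card_image card_Diff_subset)
    finally show ?thesis
      using card_mono[OF _ that] nk by (simp add: n_def)
  qed
  have inj: "inj_on w X" by (rule inj_onI) (metis PowD X(1) subsetD w_low)
  have "slot_code k d (w ` X)"
  proof
    show "finite (w ` X)" using X(1) by (auto intro: finite_subset)
    show "C \<subseteq> {1..k}" if "C \<in> w ` X" for C
      using that X(1) nk by (fastforce simp: w_def)
    show "card C = k - k div 2" if "C \<in> w ` X" for C using that X(1) card_w by auto
    show "d \<le> card (C - C')" if C: "C \<in> w ` X" "C' \<in> w ` X" "C \<noteq> C'" for C C'
    proof -
      obtain x y where "x \<in> X" "y \<in> X" "C = w x" "C' = w y" "x \<noteq> y" using C by blast
      then show ?thesis using diff[of x y] X by (metis PowD subsetD)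
    qed
  qed (use assms in auto)
  moreover have "card (w ` X) = card X" using inj by (rule card_image)
  ultimately show ?thesis using X(2) by (metis n_def)
qed

theorem theorem3:
  "\<exists>c>0. \<forall>\<^sub>F k in sequentially.
     opt_randomized_ratio k (one_out_of k (k div 2)) \<ge> ereal (c * real k)"
proof (intro exI conjI)
  \<comment> \<open>1536 = 32 * 24 * 2, from \<open>d \<ge> k / 32\<close>,
    \<open>harm (card code) - 1 \<ge> k / 24\<close> and the factor 2 lost in the
    telescoping.\<close>
  show "(1 / 1536 :: real) > 0" by simp
  show "\<forall>\<^sub>F k in sequentially.
     opt_randomized_ratio k (one_out_of k (k div 2)) \<ge> ereal (1 / 1536 * real k)"
    \<comment> \<open>This threshold leaves room for \<open>3 \<le> d\<close> and for absorbing the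
      1 subtracted from the harmonic number.\<close>
    using eventually_ge_at_top[of "100 :: nat"]
  proof eventually_elim
    case (elim k)
    define d where "d = k div 2 div 8"
    have "3 \<le> d" "8 * d \<le> k div 2" using elim unfolding d_def by presburger+
    then obtain code where code: "slot_code k d code" "(6 / 5) ^ (k div 2) \<le> real (card code)"
      using ex_slot_code by blast
    have half: "real (k div 2) \<ge> (real k - 1) / 2"
    proof -
      have "k \<le> 2 * (k div 2) + 1" by simp
      then have "real k \<le> 2 * real (k div 2) + 1" by linarith
      then show ?thesis by simp
    qed
    have d: "real d \<ge> real k / 32"
    proof -
      have "k \<le> 2 * (k div 2) + 1" by simp
      moreover have "k div 2 \<le> 8 * d + 7" unfolding d_def by simp
      ultimately have "k \<le> 32 * d" using \<open>3 \<le> d\<close> by linarith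
      then show ?thesis by (simp add: field_simps flip: of_nat_mult)
    qed
    \<comment> \<open>\<open>ln (6 / 5) = - ln (5 / 6)\<close>, and \<open>ln x \<le> x - 1\<close>
      is applied at \<open>x = 5 / 6\<close>.\<close>
    have ln65: "1 / 6 \<le> ln (6 / 5 :: real)"
      using ln_le_minus_one[of "5 / 6 :: real"] ln_inverse[of "6 / 5 :: real"] by simp
    have "real (k div 2) * (1 / 6) \<le> real (k div 2) * ln (6 / 5)"
      using ln65 by (intro mult_left_mono) auto
    also have "\<dots> = ln ((6 / 5) ^ (k div 2))" by (simp add: ln_realpow)
    also have "\<dots> \<le> ln (real (card code) + 1)"
      using code(2) by (subst ln_le_cancel_iff) (auto intro: add_nonneg_pos)
    also have "\<dots> \<le> harm (card code)" by (rule ln_le_harm)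
    finally have harm: "real k / 24 \<le> harm (card code) - 1" using half elim by linarith
    have two: "2 \<le> card code"
    proof (rule ccontr)
      assume "\<not> ?thesis"
      then have "harm (card code) \<le> (harm 1 :: real)" by (intro harm_mono) simp
      then show False using harm elim by (simp add: harm_def)
    qed
    have "real k / 32 * (real k / 24) \<le> real d * (harm (card code) - 1)"
      using d harm by (intro mult_mono) auto
    then have "real k / 32 * (real k / 24) / (2 * real k)
        \<le> real d * (harm (card code) - 1) / (2 * real k)"
      by (intro divide_right_mono) auto
    moreover have "real k / 32 * (real k / 24) / (2 * real k) = 1 / 1536 * real k"
      using elim by (simp add: field_simps)
    ultimately have bound: "1 / 1536 * real k \<le> real d * (harm (card code) - 1) / (2 * real k)"
      by linarith
    show ?case
      unfolding opt_randomized_ratio_def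
    proof (rule Inf_greatest)
      fix z assume "z \<in> {ereal c | c. \<exists>M. randomized_alg k (one_out_of k (k div 2)) M \<and>
        competitive k (one_out_of k (k div 2)) c M}"
      then obtain c M where z: "z = ereal c" and M: "randomized_alg k (one_out_of k (k div 2)) M"
        and comp: "competitive k (one_out_of k (k div 2)) c M" by blast
      interpret slot_code_adversary k d code M
        using code(1) M by (simp add: slot_code_adversary_def slot_code_adversary_axioms_def)
      show "ereal (1 / 1536 * real k) \<le> z"
        unfolding z ereal_less_eq(3)
        using bound competitive_lower_bound[OF two comp] by (rule order_trans)
    qed
  qed
qed

end
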